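(* Let $D$ be any digraph, let $U\subseteq V(D)$, and suppose that $r\in V(D)$ can reach all the vertices in $U$. If $U$ is a countable union of sets that are dispersed in $D$, then $D$ has a normal arborescence that contains $U$ and is rooted in $r$.
   Context: Digraphs have no loops and no multiple edges, but may have two oppositely directed edges between two vertices. Paths and rays are directed; $r$ can reach $u$ if $D$ has a directed path from $r$ to $u$. A directed comb is the union of a directed ray $R$ with infinitely many disjoint finite directed paths (possibly trivial) that have precisely their first vertex on $R$. Its teeth are the last vertices of these paths. A set $U\subseteq V(D)$ is dispersed in $D$ if there is no directed comb in $D$ with all its teeth in $U$. An arborescence is a rooted oriented tree $T$ containing a directed path from the root to every vertex. We write $v\le_T w$ if $T$ has a directed path from $v$ to $w$, and $\lfloor v\rfloor_T=\{w: v\le_T w\}$. For an arborescence $T\subseteq D$, a $T$-path is a non-trivial directed path in $D$ that meets $T$ exactly in its endvertices. The normal assistant of $T$ in $D$ is obtained from $T$ by adding an edge $vw$ for every two $\le_T$-incomparable $v,w\in V(T)$ for which $D$ has a $T$-path from $\lfloor v\rfloor_T$ to $\lfloor w\rfloor_T$. $T$ is normal in $D$ if its normal assistant is acyclic. *)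

theory Defs
  imports "Graph_Theory.Graph_Theory" "HOL-Library.Countable_Set"
begin

(* A directed path is given by its list of vertices (vpath), which determines it in the absence
   of multiple edges. A comb is given by its ray R and the set P of the attached paths. *)

definition directed_ray :: "'a pair_pre_digraph \<Rightarrow> (nat \<Rightarrow> 'a) \<Rightarrow> bool" where
  "directed_ray D R \<longleftrightarrow> inj R \<and> (\<forall>i. R i \<rightarrow>\<^bsub>with_proj D\<^esub> R (Suc i))"

definition directed_comb :: "'a pair_pre_digraph \<Rightarrow> (nat \<Rightarrow> 'a) \<Rightarrow> 'a list set \<Rightarrow> bool" where
  "directed_comb D R P \<longleftrightarrow>
     directed_ray D R \<and> infinite P \<and>
     (\<forall>p\<in>P. vpath p (with_proj D) \<and> set p \<inter> range R = {hd p}) \<and>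
     (\<forall>p\<in>P. \<forall>q\<in>P. p \<noteq> q \<longrightarrow> set p \<inter> set q = {})"

definition teeth :: "'a list set \<Rightarrow> 'a set" where
  "teeth P = last ` P"

definition dispersed :: "'a pair_pre_digraph \<Rightarrow> 'a set \<Rightarrow> bool" where
  "dispersed D U \<longleftrightarrow> U \<subseteq> pverts D \<and> \<not> (\<exists>R P. directed_comb D R P \<and> teeth P \<subseteq> U)"

(* The library predicates forest and tree only exclude directed cycles. An oriented tree is an
   orientation of an undirected tree, so cycles are excluded in the symmetrised digraph; there
   every edge yields a cycle of length 2, which is not a cycle of the undirected graph. *)
definition oriented_tree :: "'a pair_pre_digraph \<Rightarrow> bool" where
  "oriented_tree T \<longleftrightarrow>
     pair_wf_digraph T \<and> asym (parcs T) \<and> connected (with_proj T) \<and>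
     \<not> (\<exists>p. pre_digraph.cycle (with_proj (mk_symmetric (with_proj T))) p \<and> 3 \<le> length p)"

definition arborescence :: "'a pair_pre_digraph \<Rightarrow> 'a \<Rightarrow> bool" where
  "arborescence T r \<longleftrightarrow>
     oriented_tree T \<and> r \<in> pverts T \<and> (\<forall>v\<in>pverts T. r \<rightarrow>\<^sup>*\<^bsub>with_proj T\<^esub> v)"

definition tree_le :: "'a pair_pre_digraph \<Rightarrow> 'a \<Rightarrow> 'a \<Rightarrow> bool" where
  "tree_le T v w \<longleftrightarrow> v \<rightarrow>\<^sup>*\<^bsub>with_proj T\<^esub> w"

definition up_closure :: "'a pair_pre_digraph \<Rightarrow> 'a \<Rightarrow> 'a set" where
  "up_closure T v = {w. tree_le T v w}"

definition T_path :: "'a pair_pre_digraph \<Rightarrow> 'a pair_pre_digraph \<Rightarrow> 'a list \<Rightarrow> bool" where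
  "T_path D T p \<longleftrightarrow>
     vpath p (with_proj D) \<and> 2 \<le> length p \<and> set p \<inter> pverts T = {hd p, last p}"

definition normal_assistant ::
    "'a pair_pre_digraph \<Rightarrow> 'a pair_pre_digraph \<Rightarrow> 'a pair_pre_digraph" where
  "normal_assistant D T =
     \<lparr> pverts = pverts T,
       parcs = parcs T \<union>
         {(v, w). v \<in> pverts T \<and> w \<in> pverts T \<and> \<not> tree_le T v w \<and> \<not> tree_le T w v \<and>
            (\<exists>p. T_path D T p \<and> hd p \<in> up_closure T v \<and> last p \<in> up_closure T w)} \<rparr>"

definition normal_arborescence ::
    "'a pair_pre_digraph \<Rightarrow> 'a pair_pre_digraph \<Rightarrow> 'a \<Rightarrow> bool" where
  "normal_arborescence D T r \<longleftrightarrow>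
     arborescence T r \<and> subgraph (with_proj T) (with_proj D) \<and>
     \<not> (\<exists>c. pre_digraph.cycle (with_proj (normal_assistant D T)) c)"

end

theory Submission
  imports Defs
begin

text \<open>
  The arborescence is a transfinite variant of a depth-first search tree. A piece is a vertex set
  \<open>X\<close> with a root \<open>c\<close> that reaches all of \<open>X\<close> inside \<open>X\<close>; the first piece consists of everything
  reachable from \<open>r\<close>. In every piece choose a path \<open>p\<^sub>0 \<dots> p\<^sub>m\<close> from \<open>c\<close> to a vertex of the dispersed
  set of least index that meets \<open>X\<close>. Explore the rest of \<open>X\<close> in the order of a depth-first search:
  first what is reachable from the out-neighbours of \<open>p\<^sub>m\<close>, taken along a well-order, then what
  remains and is reachable from those of \<open>p\<^sub>m\<^sub>-\<^sub>1\<close>, and so on. This splits the rest into pieces,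
  each attached to some \<open>p\<^sub>i\<close>, and the procedure is iterated \<open>\<omega>\<close> times.

  \<open>T\<close>-paths that cross between branches only lead to branches explored earlier. So, inside a piece,
  every edge of the normal assistant goes weakly forward in the order \<open>p\<^sub>0\<close>, pieces at \<open>p\<^sub>0\<close> in reverse
  order of exploration, \<open>p\<^sub>1\<close>, and so forth. A directed cycle would therefore lie in a single subpiece
  of each piece that contains it, and hence in pieces of every depth, which is impossible.
  A vertex of the \<open>k\<close>-th dispersed set that is never covered lies in a nested sequence of pieces whose
  chosen paths end in the first \<open>k\<close> dispersed sets; infinitely many of them end in the same one, and
  these yield a comb with all its teeth in it.
\<close>

section \<open>Reachability inside a vertex set, and directed paths as vertex lists\<close>

lemma rtrancl_Restr_mono:
  "(x, y) \<in> (Restr E A)\<^sup>* \<Longrightarrow> A \<subseteq> B \<Longrightarrow> (x, y) \<in> (Restr E B)\<^sup>*"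
  by (erule rtrancl_mono[THEN subsetD, rotated]) blast

lemma rtrancl_Restr_closed:
  "(x, y) \<in> (Restr E A)\<^sup>* \<Longrightarrow> x \<in> A \<Longrightarrow> y \<in> A"
  by (induction rule: rtrancl_induct) auto

text \<open>Each vertex \<open>z\<close> of the given walk satisfies both premises of the last
  assumption, so the same walk lies in \<open>B\<close>. This serves to localise reachability to a
  convex subset.\<close>

lemma rtrancl_Restr_convex:
  assumes "(x, y) \<in> (Restr E A)\<^sup>*" "x \<in> A"
    and "\<And>z. (x, z) \<in> (Restr E A)\<^sup>* \<Longrightarrow> (z, y) \<in> (Restr E A)\<^sup>* \<Longrightarrow> z \<in> B"
  shows "(x, y) \<in> (Restr E B)\<^sup>*"
  using assms(1,2) assms(3)
proof (induction rule: converse_rtrancl_induct)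
  case base
  then show ?case by simp
next
  case (step x z)
  have "x \<in> B" using step.prems(2)[of x] step.hyps by (meson converse_rtrancl_into_rtrancl rtrancl.rtrancl_refl)
  moreover have "z \<in> B" using step.prems(2)[of z] step.hyps by blast
  moreover have "(z, y) \<in> (Restr E B)\<^sup>*"
    using step.hyps step.prems by (intro step.IH) (auto intro: converse_rtrancl_into_rtrancl)
  ultimately show ?case using step.hyps by (auto intro: converse_rtrancl_into_rtrancl)
qed

text \<open>Only arcs are mentioned, so that the search can work with a bare relation
  \<open>E\<close>; a one-element list is a path for every vertex.\<close>

definition dpath :: "'a rel \<Rightarrow> 'a list \<Rightarrow> bool" where
  "dpath E p \<longleftrightarrow> p \<noteq> [] \<and> distinct p \<and> (\<forall>i. Suc i < length p \<longrightarrow> (p ! i, p ! Suc i) \<in> E)"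

lemma vwalk_arcs_conv_nth:
  "set (vwalk_arcs p) = {(p ! i, p ! Suc i) | i. Suc i < length p}"
proof (induction p rule: vwalk_arcs.induct)
  case (3 x y xs)
  have "{((x # y # xs) ! i, (x # y # xs) ! Suc i) | i. Suc i < length (x # y # xs)} =
    insert (x, y) {((y # xs) ! i, (y # xs) ! Suc i) | i. Suc i < length (y # xs)}" (is "?L = ?R")
  proof
    show "?L \<subseteq> ?R"
    proof
      fix e assume "e \<in> ?L"
      then obtain i where "e = ((x # y # xs) ! i, (x # y # xs) ! Suc i)" "Suc i < length (x # y # xs)"
        by blast
      then show "e \<in> ?R" by (cases i) auto
    qed
    show "?R \<subseteq> ?L" by force
  qed
  with 3 show ?case by simp
qed auto

lemma (in pair_wf_digraph) vpath_iff_dpath: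
  "vpath p (with_proj G) \<longleftrightarrow> dpath (parcs G) p \<and> hd p \<in> pverts G"
proof
  assume "vpath p (with_proj G)"
  then show "dpath (parcs G) p \<and> hd p \<in> pverts G"
    by (auto simp: vpath_def vwalk_def dpath_def vwalk_arcs_conv_nth)
next
  assume p: "dpath (parcs G) p \<and> hd p \<in> pverts G"
  have "p ! i \<in> pverts G" if "i < length p" for i
  proof (cases i)
    case 0
    with p that show ?thesis by (metis dpath_def hd_conv_nth)
  next
    case (Suc j)
    with p that have "(p ! j, p ! i) \<in> parcs G" by (simp add: dpath_def)
    then show ?thesis by (rule in_arcsD2)
  qed
  with p show "vpath p (with_proj G)"
    by (auto simp: vpath_def vwalk_def dpath_def vwalk_arcs_conv_nth in_set_conv_nth)
qed

lemma dpath_drop: "dpath E p \<Longrightarrow> n < length p \<Longrightarrow> dpath E (drop n p)"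
  by (auto simp: dpath_def)

lemma dpath_take: "dpath E p \<Longrightarrow> 0 < n \<Longrightarrow> dpath E (take n p)"
  by (auto simp: dpath_def)

lemma dpath_rtrancl_nth:
  assumes "dpath E p" "i \<le> j" "j < length p"
  shows "(p ! i, p ! j) \<in> (Restr E (set p))\<^sup>*"
  using assms(2,3)
proof (induction j rule: dec_induct)
  case (step j)
  then have "(p ! j, p ! Suc j) \<in> Restr E (set p)"
    using assms(1) by (simp add: dpath_def)
  with step show ?case by (meson Suc_lessD rtrancl.rtrancl_into_rtrancl)
qed simp

text \<open>A path is grown along the walk; when the walk returns to a vertex of the path, the path
  is cut off there, which keeps it distinct.\<close>

lemma ex_dpath:
  assumes "(x, y) \<in> (Restr E X)\<^sup>*" "x \<in> X"
  obtains p where "dpath E p" "hd p = x" "last p = y" "set p \<subseteq> X"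
proof -
  from assms have "\<exists>p. dpath E p \<and> hd p = x \<and> last p = y \<and> set p \<subseteq> X"
  proof (induction rule: rtrancl_induct)
    case base
    then show ?case by (intro exI[of _ "[x]"]) (simp add: dpath_def)
  next
    case (step y z)
    then obtain p where p: "dpath E p" "hd p = x" "last p = y" "set p \<subseteq> X" by blast
    show ?case
    proof (cases "z \<in> set p")
      case True
      then obtain i where i: "i < length p" "p ! i = z" by (auto simp: in_set_conv_nth)
      have "dpath E (take (Suc i) p)" using p(1) by (rule dpath_take) simp
      moreover have "hd (take (Suc i) p) = x" using p(2) by simp
      moreover have "last (take (Suc i) p) = z" using i by (simp add: take_Suc_conv_app_nth)
      moreover have "set (take (Suc i) p) \<subseteq> X" using p(4) set_take_subset by fast
      ultimately show ?thesis by blast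
    next
      case False
      have "(p ! (length p - 1), z) \<in> E" "p \<noteq> []"
        using p(1,3) step.hyps by (auto simp: dpath_def last_conv_nth)
      with False have "dpath E (p @ [z])" using p(1)
        by (auto simp: dpath_def nth_append less_Suc_eq)
          (metis One_nat_def Suc_lessI diff_Suc_1)
      with p step.hyps show ?thesis
        by (intro exI[of _ "p @ [z]"]) (auto simp: dpath_def)
    qed
  qed
  with that show ?thesis by blast
qed

section \<open>Vertices and arcs of closed walks and cycles\<close>

lemma pcas_nth:
  assumes "pcas u p v" "i < length p"
  shows "fst (p ! i) = (case i of 0 \<Rightarrow> u | Suc j \<Rightarrow> snd (p ! j))"
  using assms
proof (induction p arbitrary: u i)
  case (Cons e p)
  then show ?case by (cases i) (auto split: nat.split)
qed simp

lemma pcas_last: "pcas u p v \<Longrightarrow> p \<noteq> [] \<Longrightarrow> snd (last p) = v"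
  by (induction p arbitrary: u) auto

lemma pawalk_verts_conv: "pcas u p v \<Longrightarrow> pawalk_verts u p = u # map snd p"
  by (induction p arbitrary: u) auto

lemma pcas_rtrancl:
  assumes "pcas u p v" "e \<in> set p"
  shows "(u, fst e) \<in> (set p)\<^sup>* \<and> (snd e, v) \<in> (set p)\<^sup>*"
  using assms
proof (induction p arbitrary: u e)
  case step: (Cons a p)
  have sub: "(set p)\<^sup>* \<subseteq> (set (a # p))\<^sup>*" by (rule rtrancl_mono) auto
  have a: "(u, snd a) \<in> set (a # p)" using step.prems by (cases a) auto
  have "(snd a, v) \<in> (set p)\<^sup>*"
  proof (cases p)
    case Nil
    with step.prems show ?thesis by simp
  next
    case (Cons b q)
    then have "fst b = snd a" "b \<in> set p" using step.prems(1) by auto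
    moreover have "(snd b, v) \<in> (set p)\<^sup>*"
      using step.IH[of "snd a" b] step.prems(1) \<open>b \<in> set p\<close> by auto
    ultimately show ?thesis by (metis converse_rtrancl_into_rtrancl prod.collapse)
  qed
  then show ?case using step.IH[of "snd a" e] step.prems sub a
    by (auto intro: converse_rtrancl_into_rtrancl)
qed simp

text \<open>The acyclicity argument uses a cycle only through its arc set. Every arc of a closed
  walk based at \<open>u\<close> is reached from \<open>u\<close> and leads back to
  \<open>u\<close>.\<close>

lemma cycle_strongly_connected:
  assumes "pre_digraph.cycle (with_proj G) p"
  shows "set p \<noteq> {} \<and> set p \<subseteq> parcs G \<and> (\<forall>x\<in>Field (set p). \<forall>y\<in>Field (set p). (x, y) \<in> (set p)\<^sup>*)"
proof -
  interpret pair_pre_digraph G .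
  from assms obtain u where u: "pcas u p u" "p \<noteq> []" "set p \<subseteq> parcs G"
    unfolding cycle_def awalk_def by auto
  have *: "(u, x) \<in> (set p)\<^sup>* \<and> (x, u) \<in> (set p)\<^sup>*" if "x \<in> Field (set p)" for x
  proof -
    from that obtain e where e: "e \<in> set p" "x = fst e \<or> x = snd e" by (force simp: Field_def)
    then have "(fst e, snd e) \<in> set p" by simp
    with pcas_rtrancl[OF u(1) e(1)] e(2) show ?thesis
      by (metis converse_rtrancl_into_rtrancl rtrancl.rtrancl_into_rtrancl)
  qed
  show ?thesis using u * by (auto intro: rtrancl_trans)
qed

lemma rtrancl_mono_on:
  assumes "(x, y) \<in> C\<^sup>*" and "\<And>a b. (a, b) \<in> C \<Longrightarrow> (f a :: nat) \<le> f b"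
  shows "f x \<le> f y"
  using assms(1) by (induction rule: rtrancl_induct) (auto dest: assms(2))

section \<open>A criterion for arborescences\<close>

text \<open>Unique parents and a parentless root make the depth \<open>d\<close> of a vertex well
  defined. On an undirected cycle, both neighbours of a deepest vertex are its parent and hence
  equal, which is impossible from length 3 on.\<close>

lemma arborescenceI:
  assumes sub: "parcs T \<subseteq> pverts T \<times> pverts T" and r: "r \<in> pverts T"
    and reach: "\<And>v. v \<in> pverts T \<Longrightarrow> (r, v) \<in> (parcs T)\<^sup>*"
    and root: "\<And>v. (v, r) \<notin> parcs T"
    and parent: "\<And>u v w. (u, w) \<in> parcs T \<Longrightarrow> (v, w) \<in> parcs T \<Longrightarrow> u = v"
  shows "arborescence T r"
proof -
  interpret pair_wf_digraph T using sub by unfold_locales auto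
  have uniq: "m = n" if "(r, v) \<in> parcs T ^^ m" "(r, v) \<in> parcs T ^^ n" for m n v
    using that
  proof (induction m arbitrary: n v)
    case 0
    then show ?case using root by (cases n) auto
  next
    case (Suc m)
    from Suc.prems(1) obtain u where u: "(r, u) \<in> parcs T ^^ m" "(u, v) \<in> parcs T" by auto
    with root have "v \<noteq> r" by auto
    with Suc.prems(2) obtain k where k: "n = Suc k" by (cases n) auto
    with Suc.prems(2) obtain w where w: "(r, w) \<in> parcs T ^^ k" "(w, v) \<in> parcs T" by auto
    with parent u have "u = w" by blast
    with Suc.IH u(1) w(1) k show ?case by simp
  qed
  define d where "d v = (THE n. (r, v) \<in> parcs T ^^ n)" for v
  have d: "d v = n" if "(r, v) \<in> parcs T ^^ n" for v n
    unfolding d_def using that uniq by blast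
  have d_arc: "d v = Suc (d u)" if "(u, v) \<in> parcs T" for u v
  proof -
    from reach that sub obtain n where n: "(r, u) \<in> parcs T ^^ n"
      by (meson mem_Sigma_iff rtrancl_power subsetD)
    with that have "(r, v) \<in> parcs T ^^ Suc n" by auto
    with n show ?thesis by (metis d)
  qed
  let ?S = "with_proj (mk_symmetric (with_proj T))"
  have S: "parcs (mk_symmetric (with_proj T)) = parcs T \<union> (parcs T)\<inverse>"
    by (auto simp: mk_symmetric_def)
  have SV: "pverts (mk_symmetric (with_proj T)) = pverts T" by (simp add: mk_symmetric_def)
  have False if p: "pre_digraph.cycle ?S p" and len: "3 \<le> length p" for p
  proof -
    interpret S: pair_pre_digraph "mk_symmetric (with_proj T)" .
    from p obtain u where u: "pcas u p u" "set p \<subseteq> parcs T \<union> (parcs T)\<inverse>"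
        and dist: "distinct (tl (pawalk_verts u p))"
      unfolding S.cycle_def S.awalk_def S by auto
    define n where "n = length p"
    have dist: "distinct (map snd p)" using dist pawalk_verts_conv[OF u(1)] by simp
    \<comment> \<open>Periodic indexing of the vertices of the cycle: arc number
      \<open>Suc i mod n\<close> leads from \<open>x i\<close> to \<open>x (Suc i)\<close>.\<close>
    define x where "x i = snd (p ! (i mod n))" for i
    have n: "n \<ge> 3" using len n_def by simp
    then have ne: "p \<noteq> []" unfolding n_def by auto
    have lt: "k mod n < length p" for k using ne unfolding n_def by simp
    have fst_x: "fst (p ! (Suc i mod n)) = x i" for i
    proof (cases "Suc i mod n")
      case 0
      then have "i mod n = n - 1" by (metis mod_Suc Suc_eq_plus1 add_diff_cancel_right' nat.distinct(1))
      then have "x i = snd (last p)" unfolding x_def n_def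
        using n n_def by (subst last_conv_nth) auto
      also have "\<dots> = u" using pcas_last[OF u(1)] ne by simp
      finally show ?thesis using 0 pcas_nth[OF u(1), of 0] ne by simp
    next
      case (Suc j)
      then have "j = i mod n" by (metis mod_Suc nat.inject nat.distinct(1))
      then show ?thesis using pcas_nth[OF u(1) lt[of "Suc i"]] Suc by (simp add: x_def)
    qed
    have x_arc: "(x i, x (Suc i)) \<in> parcs T \<or> (x (Suc i), x i) \<in> parcs T" for i
    proof -
      have "p ! (Suc i mod n) \<in> set p" using lt by simp
      moreover have "p ! (Suc i mod n) = (x i, x (Suc i))"
        using fst_x[of i] by (simp add: x_def prod_eq_iff)
      ultimately show ?thesis using u(2) by auto
    qed
    define m where "m = Max ((d \<circ> x) ` {..<n})"
    have "m \<in> (d \<circ> x) ` {..<n}" unfolding m_def using n by (intro Max_in) (auto simp: lessThan_empty_iff)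
    then obtain i where i: "i < n" "m = d (x i)" by auto
    have max: "d (x j) \<le> d (x i)" for j
    proof -
      have "x j = x (j mod n)" by (simp add: x_def)
      then have "d (x j) \<in> (d \<circ> x) ` {..<n}" using n by auto
      then show ?thesis unfolding i(2)[symmetric] m_def by (intro Max_ge) auto
    qed
    \<comment> \<open>The cyclic predecessor of \<open>i\<close>; adding \<open>n\<close> first
      avoids truncated subtraction at \<open>i = 0\<close>.\<close>
    define j where "j = i + n - 1"
    have j: "Suc j = i + n" using n j_def by simp
    have xj: "x (Suc j) = x i" unfolding j by (simp add: x_def)
    \<comment> \<open>No vertex of the cycle is deeper than \<open>x i\<close>, while every arc
      raises the depth by one. So both arcs at \<open>x i\<close> point towards it.\<close>
    have "(x j, x i) \<in> parcs T" using x_arc[of j] max[of j] d_arc[of "x i" "x j"] unfolding xj by auto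
    moreover have "(x (Suc i), x i) \<in> parcs T"
      using x_arc[of i] max[of "Suc i"] d_arc[of "x i" "x (Suc i)"] by auto
    ultimately have "x j = x (Suc i)" by (rule parent)
    then have "j mod n = Suc i mod n"
      using nth_eq_iff_index_eq[OF dist, of "j mod n" "Suc i mod n"] lt by (simp add: x_def)
    then have "Suc j mod n = Suc (Suc i) mod n" by (metis mod_Suc_eq)
    then have "i mod n = (i + 2) mod n" unfolding j by simp
    then have "n dvd 2" using mod_eq_dvd_iff_nat[of i "i + 2" n] by simp
    with n show False by (auto dest: dvd_imp_le)
  qed
  moreover have "asym (parcs T)" by (rule asymI) (metis d_arc n_not_Suc_n Suc_n_not_le_n le_SucI order_refl)
  moreover have "connected (with_proj T)"
    unfolding connected_def strongly_connected_def
  proof (intro conjI ballI)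
    interpret S: pair_wf_digraph "mk_symmetric (with_proj T)"
      using sub by unfold_locales (auto simp: S SV)
    fix v w assume "v \<in> verts ?S" "w \<in> verts ?S"
    then have "v \<in> pverts T" "w \<in> pverts T" by (simp_all add: SV)
    \<comment> \<open>Any two vertices are joined through \<open>r\<close>: against the arcs up to
      \<open>r\<close>, then along the arcs.\<close>
    then have "(r, v) \<in> (parcs T)\<^sup>*" "(r, w) \<in> (parcs T)\<^sup>*" using reach by auto
    then have "(v, r) \<in> ((parcs T)\<inverse>)\<^sup>*" "(r, w) \<in> (parcs T)\<^sup>*" by (simp_all add: rtrancl_converse)
    then have "(v, r) \<in> (parcs T \<union> (parcs T)\<inverse>)\<^sup>*" "(r, w) \<in> (parcs T \<union> (parcs T)\<inverse>)\<^sup>*"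
      by (meson Un_upper1 Un_upper2 rtrancl_mono subsetD)+
    then show "v \<rightarrow>\<^sup>*\<^bsub>?S\<^esub> w"
      using \<open>v \<in> pverts T\<close> by (subst S.reachable_conv') (auto simp: SV S)
  qed (use r in \<open>auto simp: SV\<close>)
  ultimately show ?thesis
    using r reach by (auto simp: arborescence_def oriented_tree_def reachable_conv' pair_wf_digraph_axioms)
qed

section \<open>Depth-first exploration of a single piece\<close>

definition rooted :: "'a rel \<Rightarrow> 'a set \<Rightarrow> 'a \<Rightarrow> bool" where
  "rooted E X c \<longleftrightarrow> c \<in> X \<and> (\<forall>x\<in>X. (c, x) \<in> (Restr E X)\<^sup>*)"

text \<open>The well-order \<open>R\<close> decides which out-neighbour is explored first. Where the
  chosen paths end is prescribed only for the covering argument in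
  \<open>dispersed_covered\<close>.\<close>

locale dfs =
  fixes E :: "'a rel" and r :: 'a and R :: "'a rel" and path :: "'a set \<Rightarrow> 'a \<Rightarrow> 'a list"
  assumes wo: "well_order_on UNIV R"
    and path: "rooted E X c \<Longrightarrow> dpath E (path X c) \<and> hd (path X c) = c \<and> set (path X c) \<subseteq> X"
begin

lemma wo_rel: "wo_rel R"
  using wo by (metis well_order_on_Well_order wo_rel_def)

lemma R_refl: "(x, x) \<in> R"
  using wo by (metis UNIV_I refl_on_def well_order_on_def linear_order_on_def partial_order_on_def preorder_on_def)

lemma R_trans: "(x, y) \<in> R \<Longrightarrow> (y, z) \<in> R \<Longrightarrow> (x, z) \<in> R"
  using wo by (metis transD well_order_on_def linear_order_on_def partial_order_on_def preorder_on_def)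

lemma R_antisym: "(x, y) \<in> R \<Longrightarrow> (y, x) \<in> R \<Longrightarrow> x = y"
  using wo by (metis antisymD well_order_on_def linear_order_on_def partial_order_on_def)

lemma minim_in: "A \<noteq> {} \<Longrightarrow> wo_rel.minim R A \<in> A"
  using well_order_on_Field[OF wo] by (intro wo_rel.minim_in[OF wo_rel]) auto

lemma minim_least: "x \<in> A \<Longrightarrow> (wo_rel.minim R A, x) \<in> R"
  using well_order_on_Field[OF wo] by (intro wo_rel.minim_least[OF wo_rel]) auto

definition rest :: "'a set \<Rightarrow> 'a \<Rightarrow> 'a set" where
  "rest X c = X - set (path X c)"

text \<open>
  The piece of \<open>y\<close> hangs at the last path vertex from which \<open>y\<close> is reachable through the rest, and
  its root is the first suitable out-neighbour: this is the order of a depth-first search.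
\<close>

definition entries :: "'a set \<Rightarrow> 'a \<Rightarrow> nat \<Rightarrow> 'a \<Rightarrow> 'a set" where
  "entries X c i y = {x \<in> rest X c. (path X c ! i, x) \<in> E \<and> (x, y) \<in> (Restr E (rest X c))\<^sup>*}"

definition att :: "'a set \<Rightarrow> 'a \<Rightarrow> 'a \<Rightarrow> nat" where
  "att X c y = Max {i. i < length (path X c) \<and> entries X c i y \<noteq> {}}"

definition rt :: "'a set \<Rightarrow> 'a \<Rightarrow> 'a \<Rightarrow> 'a" where
  "rt X c y = wo_rel.minim R (entries X c (att X c y) y)"

text \<open>Taken as an equivalence class of the rest, so that subpieces are disjoint by
  construction; that such a class is reachable from its root is left to
  \<open>rooted_sub\<close>.\<close>

definition sub :: "'a set \<Rightarrow> 'a \<Rightarrow> 'a \<Rightarrow> 'a set" where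
  "sub X c y = {z \<in> rest X c. att X c z = att X c y \<and> rt X c z = rt X c y}"

lemma path_hd: "rooted E X c \<Longrightarrow> path X c ! 0 = c \<and> 0 < length (path X c)"
  using path[of X c] by (metis dpath_def hd_conv_nth length_greater_0_conv)

lemma root_in_path: "rooted E X c \<Longrightarrow> c \<in> set (path X c)"
  using path[of X c] by (metis dpath_def hd_in_set)

lemma entries_mono:
  assumes "(y, z) \<in> (Restr E (rest X c))\<^sup>*"
  shows "entries X c i y \<subseteq> entries X c i z"
  using assms unfolding entries_def by (auto intro: rtrancl_trans)

text \<open>On a walk from \<open>c\<close> to \<open>y\<close> inside \<open>X\<close>, the vertex
  after the last visit to the chosen path is an entry.\<close>

lemma ex_entries:
  assumes "rooted E X c" "y \<in> rest X c"
  shows "\<exists>i<length (path X c). entries X c i y \<noteq> {}"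
proof -
  have "(c, y) \<in> (Restr E X)\<^sup>*" using assms by (auto simp: rooted_def rest_def)
  then have "y \<in> set (path X c) \<or> (\<exists>i<length (path X c). entries X c i y \<noteq> {})"
  proof (induction rule: rtrancl_induct)
    case base
    then show ?case using root_in_path assms(1) by blast
  next
    case (step y z)
    show ?case
    proof (cases "z \<in> set (path X c)")
      case False
      with step.hyps have z: "z \<in> rest X c" by (simp add: rest_def)
      show ?thesis
      proof (cases "y \<in> set (path X c)")
        case True
        then obtain i where "i < length (path X c)" "y = path X c ! i" by (auto simp: in_set_conv_nth)
        moreover with step.hyps z have "z \<in> entries X c i z" by (simp add: entries_def)
        ultimately show ?thesis by blast
      next
        case False
        with step.hyps z have "(y, z) \<in> Restr E (rest X c)" by (simp add: rest_def)
        then have "entries X c i y \<subseteq> entries X c i z" for i by (intro entries_mono) blast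
        with step.IH False show ?thesis by blast
      qed
    qed simp
  qed
  with assms(2) show ?thesis by (simp add: rest_def)
qed

lemma att_props:
  assumes "rooted E X c" "y \<in> rest X c"
  shows "att X c y < length (path X c)" and "rt X c y \<in> entries X c (att X c y) y"
proof -
  have "att X c y \<in> {i. i < length (path X c) \<and> entries X c i y \<noteq> {}}"
    unfolding att_def using ex_entries[OF assms] by (intro Max_in) auto
  then show "att X c y < length (path X c)" "rt X c y \<in> entries X c (att X c y) y"
    unfolding rt_def by (auto intro!: minim_in)
qed

lemma att_ge:
  assumes "i < length (path X c)" "x \<in> entries X c i y"
  shows "i \<le> att X c y"
  unfolding att_def using assms by (intro Max_ge) auto

text \<open>Every entry for \<open>x\<close> is also an entry for \<open>y\<close>. Hence walks
  through the rest lead only to later positions or, at the same position, to subpieces explored at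
  least as early.\<close>

lemma att_mono:
  assumes "rooted E X c" "x \<in> rest X c" "(x, y) \<in> (Restr E (rest X c))\<^sup>*"
  shows "att X c x \<le> att X c y" and "att X c x = att X c y \<Longrightarrow> (rt X c y, rt X c x) \<in> R"
proof -
  have *: "rt X c x \<in> entries X c (att X c x) y"
    using att_props(2)[OF assms(1,2)] entries_mono[OF assms(3)] by blast
  then show "att X c x \<le> att X c y" using att_props(1)[OF assms(1,2)] att_ge by blast
  assume "att X c x = att X c y"
  with * show "(rt X c y, rt X c x) \<in> R" unfolding rt_def[of X c y] by (intro minim_least) simp
qed

text \<open>The root is an entry for itself at the position of \<open>y\<close>, which gives one
  inequality for each value; \<open>att_mono\<close> gives the other.\<close>

lemma att_rt:
  assumes "rooted E X c" "y \<in> rest X c"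
  shows "att X c (rt X c y) = att X c y" and "rt X c (rt X c y) = rt X c y"
proof -
  let ?c = "rt X c y"
  have e: "?c \<in> entries X c (att X c y) y" by (rule att_props[OF assms])
  then have c: "?c \<in> rest X c" "(?c, y) \<in> (Restr E (rest X c))\<^sup>*" and e': "?c \<in> entries X c (att X c y) ?c"
    by (auto simp: entries_def)
  show eq: "att X c ?c = att X c y"
    using att_mono(1)[OF assms(1) c] att_ge[OF att_props(1)[OF assms] e'] by simp
  have "(rt X c ?c, ?c) \<in> R" using e' eq unfolding rt_def[of X c ?c] by (intro minim_least) simp
  moreover have "(?c, rt X c ?c) \<in> R" using att_mono(2)[OF assms(1) c] eq by simp
  ultimately show "rt X c ?c = ?c" by (rule R_antisym)
qed

text \<open>By \<open>att_mono\<close>, position and root change monotonically along a walk, so they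
  are constant between two vertices of one class.\<close>

lemma sub_convex:
  assumes "rooted E X c" "x \<in> sub X c u" "y \<in> sub X c u"
    and "(x, z) \<in> (Restr E (rest X c))\<^sup>*" "(z, y) \<in> (Restr E (rest X c))\<^sup>*"
  shows "z \<in> sub X c u"
proof -
  have x: "x \<in> rest X c" and y: "y \<in> rest X c" using assms by (auto simp: sub_def)
  have z: "z \<in> rest X c" by (rule rtrancl_Restr_closed[OF assms(4) x])
  note m1 = att_mono[OF assms(1) x assms(4)] and m2 = att_mono[OF assms(1) z assms(5)]
  have "att X c z = att X c u" using m1(1) m2(1) assms(2,3) by (simp add: sub_def)
  moreover with m1(2) m2(2) have "rt X c z = rt X c u"
    using assms(2,3) by (intro R_antisym) (simp_all add: sub_def)
  ultimately show ?thesis using z by (simp add: sub_def)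
qed

lemma rt_in_sub:
  assumes "rooted E X c" "y \<in> rest X c"
  shows "rt X c y \<in> sub X c y"
  using att_rt[OF assms] att_props(2)[OF assms] by (simp add: sub_def entries_def)

text \<open>The root reaches each vertex of its class through the rest, and by convexity such a walk
  never leaves the class.\<close>

lemma rooted_sub:
  assumes "rooted E X c" "y \<in> rest X c"
  shows "rooted E (sub X c y) (rt X c y)"
  unfolding rooted_def
proof (intro conjI ballI)
  show rt: "rt X c y \<in> sub X c y" by (rule rt_in_sub[OF assms])
  fix z assume z: "z \<in> sub X c y"
  then have "z \<in> rest X c" "rt X c z = rt X c y" by (simp_all add: sub_def)
  with att_props(2)[OF assms(1), of z]
  have "(rt X c y, z) \<in> (Restr E (rest X c))\<^sup>*" by (simp add: entries_def)
  then show "(rt X c y, z) \<in> (Restr E (sub X c y))\<^sup>*"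
    by (rule rtrancl_Restr_convex) (use rt sub_convex[OF assms(1) rt z] in \<open>auto simp: sub_def\<close>)
qed

lemma rt_arc:
  assumes "rooted E X c" "y \<in> rest X c"
  shows "(path X c ! att X c y, rt X c y) \<in> E"
  using att_props(2)[OF assms] by (simp add: entries_def)

lemma sub_eq: "z \<in> sub X c y \<Longrightarrow> sub X c z = sub X c y \<and> rt X c z = rt X c y"
  by (auto simp: sub_def)

section \<open>The nested family of pieces\<close>

text \<open>The index is the depth of iteration. The vertex \<open>y\<close> is a mere
  representative: by \<open>sub_eq\<close>, all vertices of a subpiece yield the same set and
  root.\<close>

inductive piece :: "nat \<Rightarrow> 'a set \<Rightarrow> 'a \<Rightarrow> bool" where
  piece_0: "piece 0 (E\<^sup>* `` {r}) r"
| piece_Suc: "piece n X c \<Longrightarrow> y \<in> rest X c \<Longrightarrow> piece (Suc n) (sub X c y) (rt X c y)"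

lemma piece_rooted: "piece n X c \<Longrightarrow> rooted E X c"
proof (induction rule: piece.induct)
  case piece_0
  show ?case unfolding rooted_def
  proof (intro conjI ballI)
    fix x assume "x \<in> E\<^sup>* `` {r}"
    then have "(r, x) \<in> (Restr E UNIV)\<^sup>*" by simp
    then show "(r, x) \<in> (Restr E (E\<^sup>* `` {r}))\<^sup>*" by (rule rtrancl_Restr_convex) auto
  qed simp
qed (rule rooted_sub)

text \<open>By induction both pieces come from the same parent, where both are the class of
  \<open>y\<close>.\<close>

lemma piece_unique:
  assumes "piece n X c" "piece n X' c'" "y \<in> X" "y \<in> X'"
  shows "X = X' \<and> c = c'"
  using assms
proof (induction arbitrary: X' c' rule: piece.induct)
  case piece_0
  then show ?case by (cases rule: piece.cases) auto
next
  case (piece_Suc n X c u)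
  from piece_Suc.prems(1) obtain Z d v where Z: "piece n Z d" "v \<in> rest Z d" "X' = sub Z d v" "c' = rt Z d v"
    by (cases rule: piece.cases) auto
  have "y \<in> X" "y \<in> Z" using piece_Suc.prems Z by (auto simp: sub_def rest_def)
  with piece_Suc.IH Z(1) have "X = Z \<and> c = d" by blast
  with Z piece_Suc.prems show ?case using sub_eq[of y X c u] sub_eq[of y X c v] by simp
qed

lemma piece_anti:
  assumes "piece n X c" "m < n"
  obtains Z d y where "piece m Z d" "y \<in> rest Z d" "X \<subseteq> sub Z d y" "X \<subseteq> rest Z d"
proof -
  from assms have "\<exists>Z d y. piece m Z d \<and> y \<in> rest Z d \<and> X \<subseteq> sub Z d y"
  proof (induction rule: piece.induct)
    case (piece_Suc n X c u)
    show ?case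
    proof (cases "m = n")
      case False
      with piece_Suc obtain Z d y where "piece m Z d" "y \<in> rest Z d" "X \<subseteq> sub Z d y" by auto
      then show ?thesis by (force simp: sub_def rest_def)
    qed (use piece_Suc in auto)
  qed simp
  then obtain Z d y where Z: "piece m Z d" "y \<in> rest Z d" "X \<subseteq> sub Z d y" by blast
  then have "X \<subseteq> rest Z d" by (auto simp: sub_def)
  with Z show ?thesis by (rule that)
qed

text \<open>The piece of depth \<open>n\<close> around \<open>Z\<close> meets \<open>X\<close> in
  \<open>v\<close>, and so equals \<open>X\<close>.\<close>

lemma piece_le:
  assumes "piece m Z d" "piece n X c" "n \<le> m" "v \<in> Z" "v \<in> X"
  shows "Z \<subseteq> X"
proof (cases "n = m")
  case True
  then show ?thesis using assms piece_unique by blast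
next
  case False
  with assms(3) have "n < m" by simp
  with assms(1) obtain X' c' y where X': "piece n X' c'" "y \<in> rest X' c'" "Z \<subseteq> sub X' c' y" "Z \<subseteq> rest X' c'"
    by (rule piece_anti)
  then have "v \<in> X'" "Z \<subseteq> X'" using assms(4) by (auto simp: rest_def)
  then show ?thesis using piece_unique[OF X'(1) assms(2) _ assms(5)] by simp
qed

lemma piece_less:
  assumes "piece m Z d" "piece n X c" "n < m" "v \<in> Z" "v \<in> X"
  shows "Z \<subseteq> sub X c v" and "v \<in> rest X c"
proof -
  obtain X' c' y where *: "piece n X' c'" "y \<in> rest X' c'" "Z \<subseteq> sub X' c' y" "Z \<subseteq> rest X' c'"
    using piece_anti[OF assms(1,3)] by blast
  then have "X' = X" "c' = c" using piece_unique[OF *(1) assms(2), of v] assms by (auto simp: rest_def)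
  with * assms(4) show "Z \<subseteq> sub X c v" "v \<in> rest X c" using sub_eq[of v X c y] by auto
qed

text \<open>A vertex on a chosen path is removed from the rest and so lies in no deeper
  piece.\<close>

lemma path_piece_unique:
  assumes "piece n X c" "v \<in> set (path X c)" "piece m Z d" "v \<in> set (path Z d)"
  shows "n = m \<and> X = Z \<and> c = d"
proof -
  have "v \<in> X" "v \<in> Z" using assms piece_rooted path by blast+
  then have "\<not> n < m" "\<not> m < n"
    using piece_less(2)[OF assms(3,1)] piece_less(2)[OF assms(1,3)] assms by (auto simp: rest_def)
  then have "n = m" by simp
  with piece_unique assms \<open>v \<in> X\<close> \<open>v \<in> Z\<close> show ?thesis by blast
qed

section \<open>The arborescence formed by the chosen paths\<close>

definition tverts :: "'a set" where
  "tverts = {v. \<exists>n X c. piece n X c \<and> v \<in> set (path X c)}"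

inductive_set tarcs :: "'a rel" where
  path_arc: "piece n X c \<Longrightarrow> Suc i < length (path X c) \<Longrightarrow> (path X c ! i, path X c ! Suc i) \<in> tarcs"
| sub_arc: "piece n X c \<Longrightarrow> y \<in> rest X c \<Longrightarrow> (path X c ! att X c y, rt X c y) \<in> tarcs"

lemma tvertsI: "piece n X c \<Longrightarrow> v \<in> set (path X c) \<Longrightarrow> v \<in> tverts"
  by (auto simp: tverts_def)

lemma rt_in_path_sub:
  assumes "piece n X c" "y \<in> rest X c"
  shows "rt X c y \<in> set (path (sub X c y) (rt X c y))"
  by (rule root_in_path, rule rooted_sub, rule piece_rooted) fact+

lemma tarcs_sub_tverts: "tarcs \<subseteq> tverts \<times> tverts"
proof (rule subrelI)
  fix a b assume "(a, b) \<in> tarcs"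
  then show "(a, b) \<in> tverts \<times> tverts"
  proof cases
    case (path_arc n X c i)
    then show ?thesis by (auto intro: tvertsI)
  next
    case (sub_arc n X c y)
    then show ?thesis using att_props(1)[OF piece_rooted] rt_in_path_sub
      by (auto intro: tvertsI piece_Suc)
  qed
qed

lemma tarcs_sub_E: "tarcs \<subseteq> E"
proof (rule subrelI)
  fix a b assume "(a, b) \<in> tarcs"
  then show "(a, b) \<in> E"
  proof cases
    case (path_arc n X c i)
    then show ?thesis using path[OF piece_rooted] by (simp add: dpath_def)
  next
    case (sub_arc n X c y)
    then show ?thesis using rt_arc[OF piece_rooted] by simp
  qed
qed

lemma path_le:
  assumes "piece n X c" "i \<le> j" "j < length (path X c)"
  shows "(path X c ! i, path X c ! j) \<in> tarcs\<^sup>*"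
  using assms(2,3)
proof (induction j rule: dec_induct)
  case (step j)
  then show ?case using path_arc[OF assms(1), of j] by (meson Suc_lessD rtrancl.rtrancl_into_rtrancl)
qed simp

text \<open>One level down, the tree leads from the root of the parent piece along its path to the
  attachment vertex and from there by one arc to the root of the subpiece.\<close>

lemma root_le:
  assumes "piece n X c" "piece m Z d" "n \<le> m" "Z \<subseteq> X"
  shows "(c, d) \<in> tarcs\<^sup>*"
  using assms(3,2,4)
proof (induction m arbitrary: Z d rule: dec_induct)
  case base
  then have "d \<in> Z" "d \<in> X" using piece_rooted by (auto simp: rooted_def)
  then show ?case using piece_unique[OF base(1) assms(1)] by blast
next
  case (step m)
  from step.prems(1) obtain Y e y where Y: "piece m Y e" "y \<in> rest Y e" "Z = sub Y e y" "d = rt Y e y"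
    by (cases rule: piece.cases) auto
  have d: "d \<in> Z" using piece_rooted[OF step.prems(1)] by (simp add: rooted_def)
  with Y have "d \<in> Y" by (auto simp: sub_def rest_def)
  with d step.prems(2) have "Y \<subseteq> X" using piece_le[OF Y(1) assms(1) step.hyps(1)] by blast
  with step.IH Y(1) have "(c, e) \<in> tarcs\<^sup>*" by blast
  also have "(e, path Y e ! att Y e y) \<in> tarcs\<^sup>*"
    using path_le[OF Y(1), of 0] att_props(1)[OF piece_rooted Y(2)] Y(1) path_hd piece_rooted by (metis le0)
  also have "(path Y e ! att Y e y, d) \<in> tarcs\<^sup>*" using sub_arc[OF Y(1,2)] Y(4) by blast
  finally show ?case .
qed

lemma root_le_vertex:
  assumes "piece n X c" "v \<in> X" "v \<in> tverts"
  shows "(c, v) \<in> tarcs\<^sup>*"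
proof -
  from assms(3) obtain m Z d where Z: "piece m Z d" "v \<in> set (path Z d)" by (auto simp: tverts_def)
  then have vZ: "v \<in> Z" using path piece_rooted by blast
  have "\<not> m < n" using piece_less(2)[OF assms(1) Z(1) _ assms(2) vZ] Z(2) by (auto simp: rest_def)
  then have "n \<le> m" by simp
  then have "(c, d) \<in> tarcs\<^sup>*" using root_le assms(1) Z(1) piece_le[OF Z(1) assms(1) _ vZ assms(2)] by blast
  also have "(d, v) \<in> tarcs\<^sup>*"
    using Z path_le[OF Z(1) le0] path_hd[OF piece_rooted[OF Z(1)]] by (auto simp: in_set_conv_nth)
  finally show ?thesis .
qed

text \<open>The tail \<open>v\<close> lies on the path of a single piece \<open>Z\<close>. Either
  \<open>X\<close> is \<open>Z\<close>, or \<open>Z\<close> is deeper and the whole arc lies in one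
  subpiece of \<open>X\<close>.\<close>

lemma tarc_cases:
  assumes "(v, w) \<in> tarcs" "piece n X c" "v \<in> X"
  obtains (along) i where "v = path X c ! i" "w = path X c ! Suc i" "Suc i < length (path X c)"
  | (sub) y where "y \<in> rest X c" "v = path X c ! att X c y" "w = rt X c y"
  | (deep) "v \<in> rest X c" "w \<in> sub X c v"
proof -
  from assms(1) obtain m Z d where Z: "piece m Z d" "v \<in> set (path Z d)" "w \<in> Z"
    "(\<exists>i. v = path Z d ! i \<and> w = path Z d ! Suc i \<and> Suc i < length (path Z d)) \<or>
     (\<exists>y\<in>rest Z d. v = path Z d ! att Z d y \<and> w = rt Z d y)"
  proof cases
    case (path_arc n X c i)
    show ?thesis by (rule that[OF path_arc(3)]) (use path_arc path[OF piece_rooted[OF path_arc(3)]] in \<open>auto intro: nth_mem\<close>)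
  next
    case (sub_arc n X c y)
    show ?thesis
      by (rule that[OF sub_arc(3)])
        (use sub_arc att_props(1)[OF piece_rooted] rt_in_sub[OF piece_rooted] in \<open>auto simp: sub_def rest_def\<close>)
  qed
  have vZ: "v \<in> Z" using Z path piece_rooted by blast
  have "\<not> m < n" using piece_less(2)[OF assms(2) Z(1) _ assms(3) vZ] Z(2) by (auto simp: rest_def)
  then consider "m = n" | "n < m" by linarith
  then show ?thesis
  proof cases
    case 1
    then have "X = Z" "c = d" using piece_unique[of m X c Z d v] assms vZ Z(1) by auto
    then show ?thesis using Z(4) that(1,2) by blast
  next
    case 2
    then show ?thesis using that(3) piece_less[OF Z(1) assms(2) 2 vZ assms(3)] Z(3) by blast
  qed
qed

text \<open>The head \<open>w\<close> has a unique position on the path of a unique piece. Its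
  parent is the preceding path vertex or, at position 0, the vertex to which this piece is
  attached.\<close>

lemma tarcs_parent:
  assumes "(u, w) \<in> tarcs" "(v, w) \<in> tarcs"
  shows "u = v"
proof -
  have "\<exists>n X c i. piece n X c \<and> i < length (path X c) \<and> w = path X c ! i \<and>
      (case i of 0 \<Rightarrow> \<exists>m Z d y. n = Suc m \<and> piece m Z d \<and> y \<in> rest Z d \<and> X = sub Z d y \<and> c = rt Z d y \<and>
           u = path Z d ! att Z d y
       | Suc j \<Rightarrow> u = path X c ! j)" if "(u, w) \<in> tarcs" for u
    using that
  proof cases
    case (path_arc n X c i)
    then show ?thesis by (intro exI[of _ n] exI[of _ X] exI[of _ c] exI[of _ "Suc i"]) simp
  next
    case (sub_arc n X c y)
    have "rooted E (sub X c y) (rt X c y)" using sub_arc rooted_sub piece_rooted by blast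
    then show ?thesis using sub_arc path_hd[of "sub X c y" "rt X c y"]
      by (intro exI[of _ "Suc n"] exI[of _ "sub X c y"] exI[of _ "rt X c y"] exI[of _ 0])
        (auto intro: piece_Suc)
  qed
  note * = this
  from *[OF assms(1)] obtain n X c i where 1: "piece n X c" "i < length (path X c)" "w = path X c ! i"
      "case i of 0 \<Rightarrow> \<exists>m Z d y. n = Suc m \<and> piece m Z d \<and> y \<in> rest Z d \<and> X = sub Z d y \<and> c = rt Z d y \<and>
           u = path Z d ! att Z d y
       | Suc j \<Rightarrow> u = path X c ! j" by blast
  from *[OF assms(2)] obtain n' X' c' i' where 2: "piece n' X' c'" "i' < length (path X' c')" "w = path X' c' ! i'"
      "case i' of 0 \<Rightarrow> \<exists>m Z d y. n' = Suc m \<and> piece m Z d \<and> y \<in> rest Z d \<and> X' = sub Z d y \<and> c' = rt Z d y \<and>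
           v = path Z d ! att Z d y
       | Suc j \<Rightarrow> v = path X' c' ! j" by blast
  have eq: "n = n'" "X = X'" "c = c'"
    using path_piece_unique[OF 1(1) _ 2(1), of w] 1(2,3) 2(2,3) nth_mem by metis+
  have "distinct (path X c)" using path[OF piece_rooted[OF 1(1)]] by (simp add: dpath_def)
  with 1 2 eq have "i = i'" by (simp add: nth_eq_iff_index_eq)
  show ?thesis
  proof (cases i)
    case (Suc j)
    then show ?thesis using 1(4) 2(4) eq unfolding \<open>i = i'\<close>[symmetric] by simp
  next
    case 0
    from 1(4) 0 obtain m Z d y where a: "n = Suc m" "piece m Z d" "y \<in> rest Z d" "X = sub Z d y"
      "u = path Z d ! att Z d y" by auto
    from 2(4) 0 \<open>i = i'\<close> obtain m' Z' d' y' where b: "n' = Suc m'" "piece m' Z' d'" "y' \<in> rest Z' d'"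
      "X' = sub Z' d' y'" "v = path Z' d' ! att Z' d' y'" by auto
    \<comment> \<open>Both \<open>y\<close> and \<open>y'\<close> represent the subpiece with root
      \<open>w\<close>, so their attachment positions agree.\<close>
    have y: "y \<in> sub Z d y" using a(3) by (simp add: sub_def)
    have y': "y \<in> sub Z' d' y'" using y a(4) b(4) eq(2) by simp
    have "m = m'" using a(1) b(1) eq(1) by simp
    then have Z: "Z = Z'" "d = d'"
      using piece_unique[OF a(2), of Z' d' y] b(2) y y' by (auto simp: sub_def rest_def)
    have "att Z d y = att Z d y'" using y' unfolding Z by (simp add: sub_def)
    then show ?thesis using a(5) b(5) Z by simp
  qed
qed

text \<open>The vertex \<open>r\<close> is at position 0 of the path of depth 0, so it neither
  follows a path vertex nor is the root of a subpiece.\<close>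

lemma tarcs_root: "(v, r) \<notin> tarcs"
proof
  assume "(v, r) \<in> tarcs"
  have r: "r \<in> set (path (E\<^sup>* `` {r}) r)" using root_in_path[OF piece_rooted[OF piece_0]] .
  from \<open>(v, r) \<in> tarcs\<close> show False
  proof cases
    case (path_arc n X c i)
    have "r \<in> set (path X c)" using path_arc(2,4) by (metis nth_mem)
    then have "c = r" using path_piece_unique[OF path_arc(3) _ piece_0 r] by blast
    then have "path X c ! Suc i = path X c ! 0" "distinct (path X c)" "0 < length (path X c)"
      using path_arc(2) path[OF piece_rooted[OF path_arc(3)]] path_hd[OF piece_rooted[OF path_arc(3)]]
      by (metis, metis dpath_def, metis)
    with path_arc(4) show False by (simp add: nth_eq_iff_index_eq)
  next
    case (sub_arc n X c y)
    have "r \<in> set (path (sub X c y) (rt X c y))"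
      using rt_in_path_sub[OF sub_arc(3,4)] sub_arc(2) by metis
    from path_piece_unique[OF piece_Suc[OF sub_arc(3,4)] this piece_0 r] show False by simp
  qed
qed

definition tgraph :: "'a pair_pre_digraph" where
  "tgraph = \<lparr>pverts = tverts, parcs = tarcs\<rparr>"

lemma tgraph_simps [simp]: "pverts tgraph = tverts" "parcs tgraph = tarcs"
  by (simp_all add: tgraph_def)

lemma piece_reachable: "piece n X c \<Longrightarrow> X \<subseteq> E\<^sup>* `` {r}"
proof (induction rule: piece.induct)
  case (piece_Suc n X c y)
  then show ?case by (auto simp: sub_def rest_def)
qed simp

lemma tverts_reachable: "tverts \<subseteq> E\<^sup>* `` {r}"
proof
  fix v assume "v \<in> tverts"
  then obtain n X c where X: "piece n X c" "v \<in> set (path X c)" by (auto simp: tverts_def)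
  then have "v \<in> X" using path[OF piece_rooted[OF X(1)]] by blast
  with piece_reachable[OF X(1)] show "v \<in> E\<^sup>* `` {r}" by blast
qed

lemma tgraph_arborescence: "arborescence tgraph r"
proof (rule arborescenceI)
  show "r \<in> pverts tgraph"
    using root_in_path[OF piece_rooted[OF piece_0]] tvertsI[OF piece_0] by simp
  show "(r, v) \<in> (parcs tgraph)\<^sup>*" if "v \<in> pverts tgraph" for v
    using that root_le_vertex[OF piece_0] tverts_reachable by auto
  show "parcs tgraph \<subseteq> pverts tgraph \<times> pverts tgraph" using tarcs_sub_tverts by simp
qed (use tarcs_root tarcs_parent in auto)

lemma tree_le_tgraph:
  assumes "v \<in> tverts"
  shows "tree_le tgraph v w \<longleftrightarrow> (v, w) \<in> tarcs\<^sup>*"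
proof -
  interpret T: pair_wf_digraph tgraph
    using tarcs_sub_tverts by unfold_locales auto
  show ?thesis using assms by (simp add: tree_le_def T.reachable_conv')
qed

section \<open>Arcs and crossing paths go forward within a piece\<close>

lemma tarc_desc:
  assumes "piece n X c" "v \<in> X" "(v, w) \<in> tarcs"
  shows "w \<in> X" and "v \<in> rest X c \<Longrightarrow> w \<in> sub X c v"
proof -
  have r: "rooted E X c" by (rule piece_rooted[OF assms(1)])
  have "w \<in> X \<and> (v \<in> rest X c \<longrightarrow> w \<in> sub X c v)"
    using assms(3,1,2)
  proof (cases rule: tarc_cases)
    case (along i)
    then show ?thesis using path[OF r] nth_mem by (auto simp: rest_def)
  next
    case (sub y)
    then show ?thesis using att_props(1)[OF r sub(1)] rt_in_sub[OF r sub(1)] by (auto simp: rest_def sub_def)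
  next
    case deep
    then show ?thesis by (auto simp: rest_def sub_def)
  qed
  then show "w \<in> X" "v \<in> rest X c \<Longrightarrow> w \<in> sub X c v" by auto
qed

text \<open>Up-closures do not leave subpieces; thus the ends of a \<open>T\<close>-path can stand
  in for the incomparable vertices whose up-closures it joins.\<close>

lemma tree_desc:
  assumes "(v, w) \<in> tarcs\<^sup>*" "piece n X c" "v \<in> X"
  shows "w \<in> X" and "v \<in> rest X c \<Longrightarrow> w \<in> sub X c v"
proof -
  have X: "w \<in> X" if "(v, w) \<in> tarcs\<^sup>*" for w
    using that
  proof (induction rule: rtrancl_induct)
    case (step y z)
    from assms(2) step.IH step.hyps(2) show ?case by (rule tarc_desc(1))
  qed (rule assms(3))
  then show "w \<in> X" using assms(1) by blast
  show "w \<in> sub X c v" if "v \<in> rest X c"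
    using assms(1)
  proof (induction rule: rtrancl_induct)
    case base
    then show ?case using that by (simp add: sub_def)
  next
    case (step y z)
    from step.IH have y: "y \<in> rest X c" by (simp add: sub_def)
    have "z \<in> sub X c y" using assms(2) X[OF step.hyps(1)] step.hyps(2) y by (rule tarc_desc(2))
    then show ?case using sub_eq[OF step.IH] by simp
  qed
qed

text \<open>
  The path vertex \<open>p\<^sub>i\<close> gets position \<open>2 i\<close>, and all pieces attached to it share position \<open>2 i + 1\<close>.
\<close>

definition key :: "'a set \<Rightarrow> 'a \<Rightarrow> 'a \<Rightarrow> nat" where
  "key X c v = (if v \<in> rest X c then 2 * att X c v + 1
     else 2 * (THE i. i < length (path X c) \<and> path X c ! i = v))"

lemma key_path:
  assumes "rooted E X c" "i < length (path X c)"
  shows "key X c (path X c ! i) = 2 * i"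
proof -
  have "distinct (path X c)" using path[OF assms(1)] by (simp add: dpath_def)
  then have "(THE j. j < length (path X c) \<and> path X c ! j = path X c ! i) = i"
    using assms(2) nth_eq_iff_index_eq by (intro the_equality) blast+
  then show ?thesis using assms(2) by (simp add: key_def rest_def)
qed

lemma key_rest: "v \<in> rest X c \<Longrightarrow> key X c v = 2 * att X c v + 1"
  by (simp add: key_def)

text \<open>A lexicographic preorder. The arguments of \<open>R\<close> are swapped because, at one
  attachment vertex, pieces explored later come first.\<close>

definition forward :: "'a set \<Rightarrow> 'a \<Rightarrow> 'a \<Rightarrow> 'a \<Rightarrow> bool" where
  "forward X c v w \<longleftrightarrow> key X c v \<le> key X c w \<and>
     (v \<in> rest X c \<and> w \<in> rest X c \<and> att X c v = att X c w \<longrightarrow> (rt X c w, rt X c v) \<in> R)"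

lemma forward_sub: "w \<in> sub X c v \<Longrightarrow> v \<in> rest X c \<Longrightarrow> forward X c v w"
  by (auto simp: forward_def sub_def key_rest R_refl)

lemma tarc_forward:
  assumes "piece n X c" "v \<in> X" "(v, w) \<in> tarcs"
  shows "forward X c v w"
proof -
  have r: "rooted E X c" by (rule piece_rooted[OF assms(1)])
  from assms(3,1,2) show ?thesis
  proof (cases rule: tarc_cases)
    case (along i)
    then have "v \<notin> rest X c" by (simp add: rest_def)
    with along show ?thesis using key_path[OF r, of i] key_path[OF r, of "Suc i"] by (simp add: forward_def)
  next
    case (sub y)
    have lt: "att X c y < length (path X c)" by (rule att_props(1)[OF r sub(1)])
    then have "v \<notin> rest X c" using sub by (simp add: rest_def)
    moreover have "w \<in> rest X c" using rt_in_sub[OF r sub(1)] sub by (simp add: sub_def)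
    ultimately show ?thesis using key_path[OF r lt] key_rest[of w X c] att_rt(1)[OF r sub(1)] sub
      by (simp add: forward_def)
  next
    case deep
    then show ?thesis using forward_sub by blast
  qed
qed

lemma tree_key_mono:
  assumes "(v, w) \<in> tarcs\<^sup>*" "piece n X c" "v \<in> X"
  shows "key X c v \<le> key X c w"
  using assms(1)
proof (induction rule: rtrancl_induct)
  case (step y z)
  then show ?case using tarc_forward[OF assms(2) tree_desc(1)[OF step.hyps(1) assms(2,3)]]
    by (force simp: forward_def)
qed simp

text \<open>Here \<open>S\<close> is to be the vertex set of a \<open>T\<close>-path from
  \<open>a\<close> to \<open>b\<close>. It cannot meet the path chosen in a surrounding piece, which
  consists of tree vertices other than \<open>a\<close> and \<open>b\<close>. So by induction it
  stays in the rest, where \<open>sub_convex\<close> applies.\<close>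

lemma piece_convex:
  assumes "piece n X c" "a \<in> X" "b \<in> X" "S \<inter> tverts \<subseteq> {a, b}" "a \<in> S"
    and "(a, z) \<in> (Restr E S)\<^sup>*" "(z, b) \<in> (Restr E S)\<^sup>*"
  shows "z \<in> X"
  using assms(1-3,6,7)
proof (induction arbitrary: z rule: piece.induct)
  case piece_0
  have "(a, z) \<in> E\<^sup>*" using piece_0.prems(3) by (rule rtrancl_mono[THEN subsetD, rotated]) auto
  with piece_0.prems(1) show ?case by auto
next
  case (piece_Suc n X c u)
  have ab: "a \<in> rest X c" "b \<in> rest X c" "a \<in> X" "b \<in> X"
    using piece_Suc.prems by (auto simp: sub_def rest_def)
  have in_rest: "y \<in> rest X c" if "(a, y) \<in> (Restr E S)\<^sup>*" "(y, b) \<in> (Restr E S)\<^sup>*" for y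
  proof (rule ccontr)
    assume "y \<notin> rest X c"
    then have "y \<in> set (path X c)" using piece_Suc.IH[OF ab(3,4) that] by (simp add: rest_def)
    then have "y \<in> tverts" using piece_Suc.hyps(1) by (rule tvertsI[rotated])
    moreover have "y \<in> S" using that(1) assms(5) by (rule rtrancl_Restr_closed)
    ultimately show False using assms(4) ab \<open>y \<notin> rest X c\<close> by auto
  qed
  have z: "z \<in> S" using piece_Suc.prems(3) assms(5) by (rule rtrancl_Restr_closed)
  have "(a, z) \<in> (Restr E (rest X c))\<^sup>*"
    using piece_Suc.prems(3) assms(5)
    by (rule rtrancl_Restr_convex) (use in_rest piece_Suc.prems(4) in \<open>blast intro: rtrancl_trans\<close>)
  moreover have "(z, b) \<in> (Restr E (rest X c))\<^sup>*"
    using piece_Suc.prems(4) z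
    by (rule rtrancl_Restr_convex) (use in_rest piece_Suc.prems(3) in \<open>blast intro: rtrancl_trans\<close>)
  ultimately show ?case
    by (rule sub_convex[OF piece_rooted[OF piece_Suc.hyps(1)] piece_Suc.prems(1,2)])
qed

text \<open>If \<open>v\<close> and \<open>w\<close> are in the rest, so is the
  \<open>T\<close>-path, and \<open>att_mono\<close> applies. If only \<open>w\<close> is on the
  chosen path, incomparability forces \<open>v\<close> to be attached before \<open>w\<close>. In
  the other two cases \<open>v\<close> and \<open>w\<close> would be comparable.\<close>

lemma cross_forward:
  assumes X: "piece n X c" and vX: "v \<in> X" "w \<in> X" and vT: "v \<in> tverts" "w \<in> tverts"
    and inc: "(v, w) \<notin> tarcs\<^sup>*" "(w, v) \<notin> tarcs\<^sup>*"
    and ab: "(v, hd p) \<in> tarcs\<^sup>*" "(w, last p) \<in> tarcs\<^sup>*"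
    and p: "dpath E p" "2 \<le> length p" "set p \<inter> tverts = {hd p, last p}"
  shows "forward X c v w"
proof -
  define a b where "a = hd p" and "b = last p"
  have r: "rooted E X c" by (rule piece_rooted[OF X])
  have pn: "a = p ! 0" "b = p ! (length p - 1)" "p \<noteq> []"
    using p(1) by (simp_all add: dpath_def hd_conv_nth last_conv_nth a_def b_def)
  have aX: "a \<in> X" and bX: "b \<in> X"
    using tree_desc(1)[OF ab(1) X vX(1)] tree_desc(1)[OF ab(2) X vX(2)] by (simp_all add: a_def b_def)
  have pT: "set p \<inter> tverts = {a, b}" using p(3) by (simp add: a_def b_def)
  have pX: "set p \<subseteq> X"
  proof
    fix z assume "z \<in> set p"
    then obtain i where i: "z = p ! i" "i < length p" by (auto simp: in_set_conv_nth)
    show "z \<in> X"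
    proof (rule piece_convex[OF X aX bX])
      show "(a, z) \<in> (Restr E (set p))\<^sup>*" "(z, b) \<in> (Restr E (set p))\<^sup>*"
        using dpath_rtrancl_nth[OF p(1)] i pn(1,2) by simp_all
    qed (use pT pn in auto)
  qed
  have path_T: "set (path X c) \<subseteq> tverts" using tvertsI[OF X] by blast
  have inner: "z \<in> rest X c" if "z \<in> set p" "z \<noteq> a" "z \<noteq> b" for z
    using that pX pT path_T by (auto simp: rest_def)
  have v_cases: "(\<exists>i. i < length (path X c) \<and> x = path X c ! i) \<or> x \<in> rest X c" if "x \<in> X" for x
    using that by (auto simp: rest_def in_set_conv_nth)
  have above: "(path X c ! i, x) \<in> tarcs\<^sup>*" if "x \<in> rest X c" "x \<in> tverts" "i \<le> att X c x" for i x
  proof -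
    have "(path X c ! i, path X c ! att X c x) \<in> tarcs\<^sup>*"
      by (rule path_le[OF X that(3) att_props(1)[OF r that(1)]])
    also have "(path X c ! att X c x, rt X c x) \<in> tarcs\<^sup>*" using sub_arc[OF X that(1)] by blast
    also have "(rt X c x, x) \<in> tarcs\<^sup>*"
      by (rule root_le_vertex[OF piece_Suc[OF X that(1)] _ that(2)]) (use that(1) in \<open>simp add: sub_def\<close>)
    finally show ?thesis .
  qed
  show ?thesis
  proof (cases "w \<in> rest X c")
    case False
    then obtain j where j: "j < length (path X c)" "w = path X c ! j" using v_cases vX by blast
    show ?thesis
    proof (cases "v \<in> rest X c")
      case False
      then obtain i where "i < length (path X c)" "v = path X c ! i" using v_cases vX by blast
      then have False using path_le[OF X, of i j] path_le[OF X, of j i] inc j by (cases "i \<le> j") auto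
      then show ?thesis ..
    next
      case True
      then have "\<not> j \<le> att X c v" using above[OF _ vT(1)] inc(2) j(2) by blast
      then show ?thesis using \<open>w \<notin> rest X c\<close> key_path[OF r j(1)] key_rest[OF True] j(2)
        by (simp add: forward_def)
    qed
  next
    case w: True
    have b: "b \<in> rest X c" "att X c b = att X c w" "rt X c b = rt X c w"
      using tree_desc(2)[OF ab(2) X vX(2) w] by (simp_all add: sub_def b_def)
    show ?thesis
    proof (cases "v \<in> rest X c")
      case v: True
      have a: "a \<in> rest X c" "att X c a = att X c v" "rt X c a = rt X c v"
        using tree_desc(2)[OF ab(1) X vX(1) v] by (simp_all add: sub_def a_def)
      have pr: "set p \<subseteq> rest X c" using inner a(1) b(1) by (metis subsetI)
      have "(a, b) \<in> (Restr E (set p))\<^sup>*" using dpath_rtrancl_nth[OF p(1), of 0 "length p - 1"] pn by simp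
      then have "(a, b) \<in> (Restr E (rest X c))\<^sup>*" using pr by (rule rtrancl_Restr_mono)
      from att_mono[OF r a(1) this] show ?thesis
        using a(2,3) b(2,3) v w by (simp add: forward_def key_rest)
    next
      case v: False
      then obtain i where i: "i < length (path X c)" "v = path X c ! i" using v_cases vX by blast
      have key: "2 * i \<le> key X c a"
        using tree_key_mono[OF ab(1) X vX(1)] key_path[OF r i(1)] i(2) by (simp add: a_def)
      \<comment> \<open>The start \<open>a\<close> lies at or after position \<open>i\<close> in the
        piece, and the crossing path passes this bound on to \<open>b\<close>, hence to
        \<open>w\<close>. This puts \<open>v\<close> below \<open>w\<close> in the tree
        order.\<close>
      have "i \<le> att X c b"
      proof (cases "a \<in> rest X c")
        case True
        have pr: "set p \<subseteq> rest X c" using inner True b(1) by (metis subsetI)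
        have "(a, b) \<in> (Restr E (set p))\<^sup>*" using dpath_rtrancl_nth[OF p(1), of 0 "length p - 1"] pn by simp
        then have "(a, b) \<in> (Restr E (rest X c))\<^sup>*" using pr by (rule rtrancl_Restr_mono)
        from att_mono(1)[OF r True this] key key_rest[OF True] show ?thesis by simp
      next
        case False
        then obtain l where l: "l < length (path X c)" "a = path X c ! l" using v_cases aX by blast
        with key key_path[OF r l(1)] have "i \<le> l" by simp
        \<comment> \<open>If \<open>a\<close> is itself a path vertex, the second vertex of
          \<open>p\<close>, possibly \<open>b\<close>, is an entry for \<open>b\<close> at the
          position of \<open>a\<close>.\<close>
        have dp: "dpath E (drop 1 p)" using p(1,2) by (intro dpath_drop) auto
        have "a \<notin> set (drop 1 p)" using p(1) pn by (cases p) (auto simp: dpath_def)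
        then have sub: "set (drop 1 p) \<subseteq> rest X c" using inner b(1) set_drop_subset[of 1 p] by blast
        have "(p ! 1, b) \<in> (Restr E (set (drop 1 p)))\<^sup>*"
          \<comment> \<open>The last index of \<open>drop 1 p\<close> is
            \<open>length p - 2\<close>.\<close>
          using dpath_rtrancl_nth[OF dp, of 0 "length p - 2"] pn p(2) by (simp add: numeral_2_eq_2 Suc_diff_Suc)
        then have 1: "(p ! 1, b) \<in> (Restr E (rest X c))\<^sup>*" using sub by (rule rtrancl_Restr_mono)
        have "drop 1 p ! 0 \<in> set (drop 1 p)" using p(2) by (intro nth_mem) simp
        then have "p ! 1 \<in> set (drop 1 p)" using p(2) by simp
        moreover have "(a, p ! 1) \<in> E" using p(1,2) pn(1) by (simp add: dpath_def)
        ultimately have "p ! 1 \<in> entries X c l b" using 1 sub l(2) by (auto simp: entries_def)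
        then have "l \<le> att X c b" by (rule att_ge[OF l(1)])
        with \<open>i \<le> l\<close> show ?thesis by simp
      qed
      then have False using above[OF w vT(2), of i] b(2) inc(1) i(2) by simp
      then show ?thesis ..
    qed
  qed
qed

section \<open>Acyclicity of the normal assistant\<close>

lemma assistant_forward:
  assumes wf: "pair_wf_digraph D" and E: "parcs D = E"
    and "piece n X c" "v \<in> X" "w \<in> X" "(v, w) \<in> parcs (normal_assistant D tgraph)"
  shows "forward X c v w"
proof (cases "(v, w) \<in> tarcs")
  case True
  then show ?thesis using tarc_forward assms by blast
next
  case False
  interpret pair_wf_digraph D by (rule wf)
  from False assms(6) obtain p where "v \<in> tverts" "w \<in> tverts"
    "\<not> tree_le tgraph v w" "\<not> tree_le tgraph w v" "T_path D tgraph p"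
    "hd p \<in> up_closure tgraph v" "last p \<in> up_closure tgraph w"
    by (auto simp: normal_assistant_def)
  then show ?thesis using assms(3-5)
    by (intro cross_forward[of n X c v w p])
      (auto simp: T_path_def up_closure_def tree_le_tgraph vpath_iff_dpath E)
qed

text \<open>On a strongly connected set of forward arcs, the preorder is constant. So the cycle
  descends from each piece into one subpiece, whereas a tree vertex lies in no piece deeper than the
  one whose path contains it.\<close>

lemma assistant_acyclic:
  assumes wf: "pair_wf_digraph D" and E: "parcs D = E"
  shows "\<not> pre_digraph.cycle (with_proj (normal_assistant D tgraph)) p"
proof
  assume "pre_digraph.cycle (with_proj (normal_assistant D tgraph)) p"
  from cycle_strongly_connected[OF this] obtain C where C: "C \<noteq> {}"
    "C \<subseteq> parcs (normal_assistant D tgraph)" "\<And>x y. x \<in> Field C \<Longrightarrow> y \<in> Field C \<Longrightarrow> (x, y) \<in> C\<^sup>*"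
    by blast
  have CT: "Field C \<subseteq> tverts"
    using C(2) tarcs_sub_tverts by (fastforce simp: Field_def normal_assistant_def)
  obtain v w where vw: "(v, w) \<in> C" using C(1) by auto
  then have v: "v \<in> Field C" "w \<in> Field C" by (auto simp: Field_def)
  \<comment> \<open>Two distinct vertices are needed below: a constant even \<open>key\<close> would
    confine the cycle to one path vertex.\<close>
  have neq: "v \<noteq> w"
  proof
    assume "v = w"
    with vw C(2) CT v have "(v, v) \<in> tarcs"
      by (auto simp: normal_assistant_def tree_le_tgraph)
    then show False
      using tgraph_arborescence by (auto simp: arborescence_def oriented_tree_def dest: asymD)
  qed
  have "\<exists>X c. piece n X c \<and> Field C \<subseteq> X" for n
  proof (induction n)
    case 0
    show ?case using piece_0 CT tverts_reachable by blast
  next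
    case (Suc n)
    then obtain X c where X: "piece n X c" "Field C \<subseteq> X" by blast
    have r: "rooted E X c" by (rule piece_rooted[OF X(1)])
    have fw: "forward X c x y" if "(x, y) \<in> C" for x y
    proof (rule assistant_forward[OF wf E X(1)])
      show "x \<in> X" "y \<in> X" using that X(2) by (auto simp: Field_def)
    qed (use that C(2) in blast)
    have "key X c x \<le> key X c y" if "x \<in> Field C" "y \<in> Field C" for x y
      using C(3)[OF that] by (rule rtrancl_mono_on) (use fw in \<open>auto simp: forward_def\<close>)
    then have key: "key X c x = key X c y" if "x \<in> Field C" "y \<in> Field C" for x y
      using that by (simp add: order_antisym)
    have in_rest: "x \<in> rest X c" if x: "x \<in> Field C" for x
    proof (rule ccontr)
      assume "x \<notin> rest X c"
      then obtain i where i: "i < length (path X c)" "x = path X c ! i"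
        using x X(2) by (auto simp: rest_def in_set_conv_nth)
      have "y = x" if "y \<in> Field C" for y
      proof (cases "y \<in> rest X c")
        case True
        have "key X c y \<noteq> key X c x"
          unfolding i(2) key_rest[OF True] key_path[OF r i(1)] by presburger
        then show ?thesis using key[OF that x] by contradiction
      next
        case False
        moreover have "y \<in> X" using that X(2) by blast
        ultimately obtain j where j: "j < length (path X c)" "y = path X c ! j"
          by (auto simp: rest_def in_set_conv_nth)
        have "j = i" using key[OF that x] unfolding i(2) j(2) key_path[OF r i(1)] key_path[OF r j(1)] by simp
        with i j show ?thesis by simp
      qed
      with v neq show False by metis
    qed
    have att: "att X c x = att X c y" if "x \<in> Field C" "y \<in> Field C" for x y
      using key[OF that] unfolding key_rest[OF in_rest[OF that(1)]] key_rest[OF in_rest[OF that(2)]] by simp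
    \<comment> \<open>Roots can only move down in \<open>R\<close> along the cycle; returning to the
      start makes them constant.\<close>
    have le: "(rt X c y, rt X c x) \<in> R" if "(x, y) \<in> C\<^sup>*" for x y
      using that
    proof (induction rule: rtrancl_induct)
      case base
      show ?case by (rule R_refl)
    next
      case (step y z)
      then have "y \<in> Field C" "z \<in> Field C" by (auto simp: Field_def)
      then have "y \<in> rest X c" "z \<in> rest X c" "att X c y = att X c z" using in_rest att by blast+
      then have "(rt X c z, rt X c y) \<in> R" using fw[OF step.hyps(2)] by (simp add: forward_def)
      then show ?case using step.IH by (rule R_trans)
    qed
    have "Field C \<subseteq> sub X c v"
    proof
      fix x assume x: "x \<in> Field C"
      have "rt X c x = rt X c v" using le[OF C(3)[OF x v(1)]] le[OF C(3)[OF v(1) x]] by (rule R_antisym[rotated])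
      then show "x \<in> sub X c v" using att[OF x v(1)] in_rest[OF x] by (simp add: sub_def)
    qed
    with piece_Suc[OF X(1) in_rest[OF v(1)]] show ?case by blast
  qed
  moreover obtain n X c where X: "piece n X c" "v \<in> set (path X c)" using v(1) CT by (auto simp: tverts_def)
  ultimately obtain Z d where Z: "piece (Suc n) Z d" "v \<in> Z" using v(1) by blast
  have "v \<in> X" using path[OF piece_rooted[OF X(1)]] X(2) by blast
  then have "v \<in> rest X c" using piece_less(2)[OF Z(1) X(1) _ Z(2)] by simp
  with X(2) show False by (simp add: rest_def)
qed

end

section \<open>A ray through infinitely many disjoint paths\<close>

text \<open>The ray follows \<open>P n\<close> up to position \<open>i n\<close> and then steps to
  the head of \<open>P (Suc n)\<close>. The remaining tails will be the paths of a comb.\<close>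

lemma ray_along_dpaths:
  fixes P :: "nat \<Rightarrow> 'a list" and i :: "nat \<Rightarrow> nat"
  assumes P: "\<And>n. dpath E (P n)" and i: "\<And>n. i n < length (P n)"
    and step: "\<And>n. (P n ! i n, hd (P (Suc n))) \<in> E"
    and disj: "\<And>m n. m \<noteq> n \<Longrightarrow> set (P m) \<inter> set (P n) = {}"
  obtains R where "inj R" "\<And>k. (R k, R (Suc k)) \<in> E"
    "\<And>n. set (drop (i n) (P n)) \<inter> range R = {P n ! i n}"
proof -
  define next_pos where "next_pos = (\<lambda>(n, j). if j < i n then (n, Suc j) else (Suc n, 0 :: nat))"
  define pos where "pos k = (next_pos ^^ k) (0, 0)" for k
  \<comment> \<open>The number of ray vertices before position \<open>j\<close> of path
    \<open>n\<close>; it inverts \<open>pos\<close>, which makes \<open>pos\<close>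
    injective.\<close>
  define f where "f = (\<lambda>(n, j). (\<Sum>m<n. Suc (i m)) + j)"
  define R where "R k = P (fst (pos k)) ! snd (pos k)" for k
  have pos_Suc: "pos (Suc k) = next_pos (pos k)" for k by (simp add: pos_def)
  have le: "snd (pos k) \<le> i (fst (pos k))" for k
  proof (induction k)
    case (Suc k)
    then show ?case by (auto simp: pos_Suc next_pos_def split: prod.splits)
  qed (simp add: pos_def)
  have f_pos: "f (pos k) = k" for k
  proof (induction k)
    case (Suc k)
    then show ?case using le[of k] by (auto simp: pos_Suc next_pos_def f_def split: prod.splits)
  qed (simp add: pos_def f_def)
  have pos_add: "pos (k + j) = (n, j)" if "pos k = (n, 0)" "j \<le> i n" for k n j
    using that(2)
  proof (induction j)
    case (Suc j)
    then show ?case by (simp add: pos_Suc next_pos_def)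
  qed (simp add: that(1))
  have ex_pos: "\<exists>k. pos k = (n, 0)" for n
  proof (induction n)
    case 0
    show ?case by (intro exI[of _ 0]) (simp add: pos_def)
  next
    case (Suc n)
    then obtain k where "pos k = (n, 0)" by blast
    from pos_add[OF this order_refl] have "pos (Suc (k + i n)) = (Suc n, 0)"
      by (simp add: pos_Suc next_pos_def)
    then show ?case by blast
  qed
  have lt: "snd (pos k) < length (P (fst (pos k)))" for k
    using le[of k] i[of "fst (pos k)"] by simp
  have R_in: "R k \<in> set (P (fst (pos k)))" for k
    unfolding R_def using lt by (rule nth_mem)
  have dist: "distinct (P n)" for n using P by (simp add: dpath_def)
  have "inj R"
  proof (rule injI)
    fix k l assume eq: "R k = R l"
    have "fst (pos k) = fst (pos l)"
    proof (rule ccontr)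
      assume "fst (pos k) \<noteq> fst (pos l)"
      from disj[OF this] R_in[of k] R_in[of l] eq show False by auto
    qed
    moreover from this have "snd (pos k) = snd (pos l)"
      using eq lt[of k] lt[of l] nth_eq_iff_index_eq[OF dist] unfolding R_def by metis
    ultimately show "k = l" using f_pos[of k] f_pos[of l] by (metis prod.collapse)
  qed
  moreover have "(R k, R (Suc k)) \<in> E" for k
  proof (cases "snd (pos k) < i (fst (pos k))")
    case True
    then have "R (Suc k) = P (fst (pos k)) ! Suc (snd (pos k))"
      by (simp add: R_def pos_Suc next_pos_def case_prod_beta)
    moreover have "Suc (snd (pos k)) < length (P (fst (pos k)))"
      using True i[of "fst (pos k)"] by simp
    ultimately show ?thesis using P[of "fst (pos k)"] unfolding R_def dpath_def by simp
  next
    case False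
    then have "snd (pos k) = i (fst (pos k))" using le[of k] by simp
    moreover from False have "R (Suc k) = hd (P (Suc (fst (pos k))))"
      using P[of "Suc (fst (pos k))"]
      by (simp add: R_def pos_Suc next_pos_def dpath_def hd_conv_nth case_prod_beta)
    ultimately show ?thesis using step[of "fst (pos k)"] by (simp add: R_def)
  qed
  moreover have "set (drop (i n) (P n)) \<inter> range R = {P n ! i n}" for n
  proof (intro equalityI subsetI)
    fix x assume x: "x \<in> set (drop (i n) (P n)) \<inter> range R"
    then obtain k where k: "x = R k" by blast
    have "x \<in> set (P n)" using x set_drop_subset[of "i n" "P n"] by blast
    then have n: "fst (pos k) = n" using R_in[of k] disj[of "fst (pos k)" n] k by blast
    from x obtain j where j: "j < length (P n) - i n" "x = P n ! (i n + j)"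
      by (auto simp: in_set_conv_nth)
    have "P n ! (i n + j) = P n ! snd (pos k)" using j(2) k n by (simp add: R_def)
    moreover have "i n + j < length (P n)" "snd (pos k) < length (P n)"
      using j(1) lt[of k] n by auto
    ultimately have "i n + j = snd (pos k)" using nth_eq_iff_index_eq[OF dist] by blast
    with le[of k] n have "j = 0" by simp
    with j(2) show "x \<in> {P n ! i n}" by simp
  next
    fix x assume x: "x \<in> {P n ! i n}"
    obtain k where "pos k = (n, 0)" using ex_pos by blast
    from pos_add[OF this order_refl] have "R (k + i n) = P n ! i n" by (simp add: R_def)
    then have "x \<in> range R" using x by (metis rangeI singletonD)
    moreover have "P n ! i n = hd (drop (i n) (P n))" using i by (simp add: hd_drop_conv_nth)
    then have "x \<in> set (drop (i n) (P n))" using x i[of n] by (metis drop_eq_Nil hd_in_set not_le singletonD)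
    ultimately show "x \<in> set (drop (i n) (P n)) \<inter> range R" by blast
  qed
  ultimately show ?thesis by (rule that)
qed

section \<open>Every vertex of the dispersed sets is covered\<close>

context dfs
begin

text \<open>A vertex on no chosen path is in the rest of each piece containing it, so the recursion
  into its subpiece never stops.\<close>

lemma uncovered_pieces:
  assumes "u \<in> E\<^sup>* `` {r}" "u \<notin> tverts"
  obtains X c where "\<And>n. piece n (X n) (c n)" "\<And>n. u \<in> rest (X n) (c n)"
    "\<And>n. c (Suc n) = rt (X n) (c n) u"
proof -
  define pc where "pc = rec_nat (E\<^sup>* `` {r}, r) (\<lambda>_ (X, c). (sub X c u, rt X c u))"
  define X c where "X n = fst (pc n)" and "c n = snd (pc n)" for n
  have XS: "X (Suc n) = sub (X n) (c n) u" "c (Suc n) = rt (X n) (c n) u" for n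
    by (simp_all add: X_def c_def pc_def split: prod.split)
  have *: "piece n (X n) (c n) \<and> u \<in> rest (X n) (c n)" for n
  proof (induction n)
    case 0
    have "X 0 = E\<^sup>* `` {r}" "c 0 = r" by (simp_all add: X_def c_def pc_def)
    then show ?case using piece_0 assms tvertsI[OF piece_0] by (auto simp: rest_def)
  next
    case (Suc n)
    then have p: "piece (Suc n) (X (Suc n)) (c (Suc n))"
      unfolding XS by (intro piece_Suc) auto
    moreover have "u \<in> X (Suc n)" using Suc.IH by (simp add: XS sub_def)
    ultimately show ?case using tvertsI[OF p] assms(2) by (auto simp: rest_def)
  qed
  show ?thesis by (rule that[of X c]) (use * XS(2) in auto)
qed

text \<open>All pieces around \<open>u\<close> meet \<open>V k\<close>, so their paths end in the
  sets up to index \<open>k\<close>. The ray turns off each path at its attachment vertex; the tails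
  from there to the ends, possibly trivial, carry the teeth.\<close>

lemma dispersed_covered:
  fixes V :: "nat \<Rightarrow> 'a set"
  assumes wf: "pair_wf_digraph D" and E: "parcs D = E" and r: "r \<in> pverts D"
    and disp: "\<And>j. dispersed D (V j)"
    and min: "\<And>X c k. rooted E X c \<Longrightarrow> X \<inter> V k \<noteq> {} \<Longrightarrow> \<exists>j\<le>k. last (path X c) \<in> V j"
    and u: "u \<in> E\<^sup>* `` {r}" "u \<in> V k"
  shows "u \<in> tverts"
proof (rule ccontr)
  assume "u \<notin> tverts"
  with u(1) obtain X c where piece: "\<And>n. piece n (X n) (c n)" and u_rest: "\<And>n. u \<in> rest (X n) (c n)"
    and c_Suc: "\<And>n. c (Suc n) = rt (X n) (c n) u"
    by (rule uncovered_pieces) blast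
  interpret pair_wf_digraph D by (rule wf)
  note rooted = piece_rooted[OF piece]
  define P where "P n = path (X n) (c n)" for n
  define i where "i n = att (X n) (c n) u" for n
  have P: "dpath E (P n)" "hd (P n) = c n" "set (P n) \<subseteq> X n" for n
    using path[OF rooted] by (simp_all add: P_def)
  have i: "i n < length (P n)" for n
    using att_props(1)[OF rooted u_rest] by (simp add: P_def i_def)
  have disj: "set (P m) \<inter> set (P n) = {}" if "m \<noteq> n" for m n
    using path_piece_unique[OF piece[of m] _ piece[of n]] that by (auto simp: P_def)
  have step: "(P n ! i n, hd (P (Suc n))) \<in> E" for n
    unfolding P(2) c_Suc using rt_arc[OF rooted u_rest] by (simp add: P_def i_def)
  obtain R where R: "inj R" "\<And>k. (R k, R (Suc k)) \<in> E"
      "\<And>n. set (drop (i n) (P n)) \<inter> range R = {P n ! i n}"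
    using ray_along_dpaths[of E P i, OF P(1) i step disj] by blast
  have "\<exists>j\<le>k. last (P n) \<in> V j" for n
    unfolding P_def by (rule min[OF rooted]) (use u(2) u_rest[of n] in \<open>auto simp: rest_def\<close>)
  then obtain j where j: "\<And>n. j n \<le> k" "\<And>n. last (P n) \<in> V (j n)" by metis
  have "finite (range j)" by (rule finite_subset[of _ "{..k}"]) (use j(1) in auto)
  then obtain n0 where N: "infinite {n. j n = j n0}"
    using pigeonhole_infinite[of UNIV j] by auto
  \<comment> \<open>The ray uses all the paths \<open>P n\<close>, but only the tails ending in the
    set selected by the pigeonhole principle belong to the comb.\<close>
  define S where "S = (\<lambda>n. drop (i n) (P n)) ` {n. j n = j n0}"
  have ne: "drop (i n) (P n) \<noteq> []" for n using i[of n] by simp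
  have disj': "set (drop (i m) (P m)) \<inter> set (drop (i n) (P n)) = {}" if "m \<noteq> n" for m n
    using disj[OF that] set_drop_subset by fast
  have "inj (\<lambda>n. drop (i n) (P n))"
  proof (rule injI)
    fix m n assume eq: "drop (i m) (P m) = drop (i n) (P n)"
    show "m = n"
    proof (rule ccontr)
      assume "m \<noteq> n"
      from disj'[OF this] ne[of n] eq show False by simp
    qed
  qed
  then have "infinite S" unfolding S_def using N by (subst finite_image_iff) (auto intro: inj_on_subset)
  have vert: "x \<in> pverts D" if "x \<in> E\<^sup>* `` {r}" for x
  proof -
    from that have "(r, x) \<in> (parcs D)\<^sup>*" using E by simp
    then show ?thesis using r by (induction rule: rtrancl_induct) (auto dest: in_arcsD2)
  qed
  have "directed_comb D R S"
    unfolding directed_comb_def directed_ray_def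
  proof (intro conjI ballI allI impI)
    show "R k \<rightarrow>\<^bsub>with_proj D\<^esub> R (Suc k)" for k using R(2) E by simp
    fix p assume "p \<in> S"
    then obtain n where n: "p = drop (i n) (P n)" by (auto simp: S_def)
    have hd: "hd p = P n ! i n" using i n by (simp add: hd_drop_conv_nth)
    show "set p \<inter> range R = {hd p}" unfolding hd unfolding n by (rule R(3))
    have "hd p \<in> X n" using subsetD[OF P(3) nth_mem[OF i]] hd by simp
    then have "hd p \<in> pverts D" using piece_reachable[OF piece] vert by blast
    then show "vpath p (with_proj D)" unfolding vpath_iff_dpath E n using dpath_drop[OF P(1) i] by simp
    fix q assume "q \<in> S" "p \<noteq> q"
    then obtain m where "q = drop (i m) (P m)" "m \<noteq> n" using n by (auto simp: S_def)
    then show "set p \<inter> set q = {}" using disj'[of n m] n by simp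
  qed fact+
  moreover have "teeth S \<subseteq> V (j n0)"
  proof
    fix x assume "x \<in> teeth S"
    then obtain n where "j n = j n0" "x = last (drop (i n) (P n))" by (auto simp: teeth_def S_def)
    then show "x \<in> V (j n0)" using j(2)[of n] i[of n] by simp
  qed
  ultimately show False using disp[of "j n0"] by (auto simp: dispersed_def)
qed

end

section \<open>Enumeration of the dispersed sets and choice of the paths\<close>

theorem theorem3:
  fixes D :: "'a pair_pre_digraph" and U :: "'a set" and r :: 'a
  assumes "pair_loopfree_digraph D"
    and "U \<subseteq> pverts D"
    and "r \<in> pverts D"
    and "\<forall>u\<in>U. r \<rightarrow>\<^sup>*\<^bsub>with_proj D\<^esub> u"
    and "\<exists>\<U>. countable \<U> \<and> (\<forall>X\<in>\<U>. dispersed D X) \<and> U = \<Union>\<U>"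
  shows "\<exists>T. normal_arborescence D T r \<and> U \<subseteq> pverts T"
proof -
  interpret pair_loopfree_digraph D by fact
  obtain \<U> where \<U>: "countable \<U>" "\<forall>X\<in>\<U>. dispersed D X" "U = \<Union>\<U>" using assms(5) by blast
  have empty: "dispersed D {}" by (auto simp: dispersed_def directed_comb_def teeth_def)
  \<comment> \<open>Adding the empty set allows an enumeration by all natural numbers even if \<U>
    is empty.\<close>
  define V where "V = from_nat_into (insert {} \<U>)"
  have "range V = insert {} \<U>" unfolding V_def using \<U>(1) by (intro range_from_nat_into) auto
  then have V: "dispersed D (V j)" "U = (\<Union>j. V j)" for j
    using \<U>(2,3) empty by (metis insertE rangeI, auto)
  define E where "E = parcs D"
  obtain R :: "'a rel" where R: "well_order_on UNIV R" using well_order_on by blast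
  have ex: "\<exists>p. dpath E p \<and> hd p = c \<and> set p \<subseteq> X \<and> (\<forall>k. X \<inter> V k \<noteq> {} \<longrightarrow> (\<exists>j\<le>k. last p \<in> V j))"
    if r: "rooted E X c" for X c
  proof (cases "\<exists>k. X \<inter> V k \<noteq> {}")
    case True
    \<comment> \<open>An end in the set of least index meeting \<open>X\<close> satisfies the
      requirement for all larger indices at once.\<close>
    define k where "k = (LEAST k. X \<inter> V k \<noteq> {})"
    have "X \<inter> V k \<noteq> {}" unfolding k_def using True by (rule LeastI_ex)
    then obtain u where u: "u \<in> X" "u \<in> V k" by blast
    then have "(c, u) \<in> (Restr E X)\<^sup>*" "c \<in> X" using r by (auto simp: rooted_def)
    then obtain p where "dpath E p" "hd p = c" "last p = u" "set p \<subseteq> X" by (rule ex_dpath)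
    moreover have "k \<le> l" if "X \<inter> V l \<noteq> {}" for l unfolding k_def using that by (rule Least_le)
    ultimately show ?thesis using u(2) by blast
  next
    case False
    \<comment> \<open>In a piece that meets none of the sets, the trivial path at \<open>c\<close>
      will do.\<close>
    then show ?thesis using r by (intro exI[of _ "[c]"]) (auto simp: dpath_def rooted_def)
  qed
  define path where "path X c = (SOME p. dpath E p \<and> hd p = c \<and> set p \<subseteq> X \<and>
    (\<forall>k. X \<inter> V k \<noteq> {} \<longrightarrow> (\<exists>j\<le>k. last p \<in> V j)))" for X c
  have chosen: "dpath E (path X c) \<and> hd (path X c) = c \<and> set (path X c) \<subseteq> X \<and>
      (\<forall>k. X \<inter> V k \<noteq> {} \<longrightarrow> (\<exists>j\<le>k. last (path X c) \<in> V j))" if "rooted E X c" for X c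
    unfolding path_def by (rule someI_ex[OF ex[OF that]])
  interpret dfs E r R path by unfold_locales (use R chosen in blast)+
  have wf: "pair_wf_digraph D" ..
  have E: "parcs D = E" by (simp add: E_def)
  have reach: "u \<in> E\<^sup>* `` {r}" if "u \<in> U" for u
    using assms(4) that reachable_rtranclI[of "with_proj D" r u] by (simp add: E_def)
  have "U \<subseteq> tverts"
  proof
    fix u assume "u \<in> U"
    then obtain k where "u \<in> V k" using V(2) by blast
    show "u \<in> tverts"
    proof (rule dispersed_covered[OF wf E assms(3) V(1)])
      show "\<exists>j\<le>k. last (path X c) \<in> V j" if "rooted E X c" "X \<inter> V k \<noteq> {}" for X c k
        using chosen[OF that(1)] that(2) by blast
    qed (rule reach[OF \<open>u \<in> U\<close>], rule \<open>u \<in> V k\<close>)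
  qed
  moreover have "tverts \<subseteq> pverts D"
  proof
    fix x assume "x \<in> tverts"
    then have "(r, x) \<in> (parcs D)\<^sup>*" using tverts_reachable E by auto
    then show "x \<in> pverts D" using assms(3) by (induction rule: rtrancl_induct) (auto dest: in_arcsD2)
  qed
  moreover have "pair_wf_digraph tgraph"
    using tgraph_arborescence by (simp add: arborescence_def oriented_tree_def)
  ultimately show ?thesis
    using tgraph_arborescence assistant_acyclic[OF wf E] tarcs_sub_E wf
    by (intro exI[of _ tgraph])
      (auto simp: normal_arborescence_def subgraph_def compatible_def wf_digraph_wp_iff E)
qed

end
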